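(* Let $J=\{1,\dots,n\}$, let $x_j\in\mathbb{R}_{\ge 0}^m$ and $y_j\in\mathbb{R}_{\ge 0}^s$ be nonzero vectors for each $j\in J$, and fix $o\in J$. Let $\theta^*$ be the optimal value of the BCC envelopment model for $\mathrm{DMU}_o$ and $R_o^M$ the maximal reference set of $\mathrm{DMU}_o$ (both defined in the context). For $M>0$ consider the mixed integer linear program in the variables $\lambda\in\mathbb{R}^n$, $I\in\{0,1\}^n$: $$\begin{aligned} \max\ & \sum_{j\in J} I_j\\ \text{s.t. } & \sum_{j\in J}\lambda_j x_{ij}\le \theta^* x_{io},\quad i=1,\dots,m,\\ & \sum_{j\in J}\lambda_j y_{rj}\ge y_{ro},\quad r=1,\dots,s,\\ & \sum_{j\in J}\lambda_j=1,\\ & I_j\le M\lambda_j,\ I_j\in\{0,1\},\ \lambda_j\ge 0,\quad j\in J. \end{aligned}$$ Then for all sufficiently large $M$ (i.e. there is $M_0>0$, depending on the data, such that for every $M\ge M_0$) the following holds: if $\lambda^*$ (together with some $I^*$) is an optimal solution of this program, then $$R_o^M=\{\mathrm{DMU}_j \mid \lambda_j^*>0\}.$$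
   Context: There are $n$ decision making units $\mathrm{DMU}_j$, $j\in J=\{1,\dots,n\}$, where $\mathrm{DMU}_j$ has input vector $x_j=(x_{1j},\dots,x_{mj})^T\in\mathbb{R}_{\ge0}^m$ and output vector $y_j=(y_{1j},\dots,y_{sj})^T\in\mathbb{R}_{\ge0}^s$, both nonzero. DMUs are identified with their indices $j\in J$. The (input-oriented) BCC envelopment model for $\mathrm{DMU}_o$, $o\in J$, is the linear program in the variables $\theta\in\mathbb{R}$, $\lambda\in\mathbb{R}^n$: $$\min\ \theta\quad\text{s.t.}\quad \sum_{j\in J}\lambda_j x_{ij}\le\theta x_{io}\ (i=1,\dots,m),\quad \sum_{j\in J}\lambda_j y_{rj}\ge y_{ro}\ (r=1,\dots,s),\quad \sum_{j\in J}\lambda_j=1,\quad \lambda_j\ge0\ (j\in J).$$ Its optimal value is denoted $\theta^*$. Reference set: if $(\theta^*,\lambda)$ is an optimal solution of the BCC envelopment model for $\mathrm{DMU}_o$, the set $\{\mathrm{DMU}_j\mid\lambda_j>0\}$ is called a reference set to $\mathrm{DMU}_o$; its members are called reference DMUs. Reference sets need not be unique, since the model may have several optimal solutions. Maximal reference set: $R_o^M$ is the set containing all the reference sets to $\mathrm{DMU}_o$, i.e. their union: $\mathrm{DMU}_j\in R_o^M$ if and only if there is an optimal solution of the BCC envelopment model for $\mathrm{DMU}_o$ with $\lambda_j>0$. (The superscript $M$ in $R_o^M$ is part of the notation and unrelated to the constant $M$ of the program.) *)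

theory Defs
  imports "HOL-Analysis.Analysis"
begin

text \<open>
  DMUs are identified with their indices, which range over the finite type \<open>'n\<close>;
  \<open>x j\<close> and \<open>y j\<close> are the input and output vectors of DMU \<open>j\<close>,
  and \<open>k\<close> is the DMU under evaluation (\<open>o\<close> is reserved syntax).
\<close>

definition bcc_feasible ::
  "('n::finite \<Rightarrow> real^'m) \<Rightarrow> ('n \<Rightarrow> real^'s) \<Rightarrow> 'n \<Rightarrow> real \<Rightarrow> real^'n \<Rightarrow> bool" where
  "bcc_feasible x y k \<theta> lam \<longleftrightarrow>
     (\<forall>i. (\<Sum>j\<in>UNIV. lam $ j * x j $ i) \<le> \<theta> * x k $ i) \<and>
     (\<forall>r. (\<Sum>j\<in>UNIV. lam $ j * y j $ r) \<ge> y k $ r) \<and>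
     (\<Sum>j\<in>UNIV. lam $ j) = 1 \<and>
     (\<forall>j. lam $ j \<ge> 0)"

definition bcc_optimal ::
  "('n::finite \<Rightarrow> real^'m) \<Rightarrow> ('n \<Rightarrow> real^'s) \<Rightarrow> 'n \<Rightarrow> real \<Rightarrow> real^'n \<Rightarrow> bool" where
  "bcc_optimal x y k \<theta> lam \<longleftrightarrow>
     bcc_feasible x y k \<theta> lam \<and>
     (\<forall>\<theta>' lam'. bcc_feasible x y k \<theta>' lam' \<longrightarrow> \<theta> \<le> \<theta>')"

text \<open>The infimum is over a nonempty set, bounded below as soon as \<open>x\<close> is nonnegative and \<open>x k\<close> nonzero.\<close>

definition bcc_value ::
  "('n::finite \<Rightarrow> real^'m) \<Rightarrow> ('n \<Rightarrow> real^'s) \<Rightarrow> 'n \<Rightarrow> real" where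
  "bcc_value x y k = Inf {\<theta>. \<exists>lam. bcc_feasible x y k \<theta> lam}"

definition reference_set ::
  "('n::finite \<Rightarrow> real^'m) \<Rightarrow> ('n \<Rightarrow> real^'s) \<Rightarrow> 'n \<Rightarrow> 'n set \<Rightarrow> bool" where
  "reference_set x y k R \<longleftrightarrow> (\<exists>\<theta> lam. bcc_optimal x y k \<theta> lam \<and> R = {j. lam $ j > 0})"

definition maximal_reference_set ::
  "('n::finite \<Rightarrow> real^'m) \<Rightarrow> ('n \<Rightarrow> real^'s) \<Rightarrow> 'n \<Rightarrow> 'n set" where
  "maximal_reference_set x y k = \<Union> {R. reference_set x y k R}"

definition milp_feasible ::
  "('n::finite \<Rightarrow> real^'m) \<Rightarrow> ('n \<Rightarrow> real^'s) \<Rightarrow> 'n \<Rightarrow> real \<Rightarrow> real^'n \<Rightarrow> real^'n \<Rightarrow> bool" where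
  "milp_feasible x y k M lam I \<longleftrightarrow>
     (\<forall>i. (\<Sum>j\<in>UNIV. lam $ j * x j $ i) \<le> bcc_value x y k * x k $ i) \<and>
     (\<forall>r. (\<Sum>j\<in>UNIV. lam $ j * y j $ r) \<ge> y k $ r) \<and>
     (\<Sum>j\<in>UNIV. lam $ j) = 1 \<and>
     (\<forall>j. I $ j \<le> M * lam $ j \<and> I $ j \<in> {0, 1} \<and> lam $ j \<ge> 0)"

definition milp_optimal ::
  "('n::finite \<Rightarrow> real^'m) \<Rightarrow> ('n \<Rightarrow> real^'s) \<Rightarrow> 'n \<Rightarrow> real \<Rightarrow> real^'n \<Rightarrow> real^'n \<Rightarrow> bool" where
  "milp_optimal x y k M lam I \<longleftrightarrow>
     milp_feasible x y k M lam I \<and>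
     (\<forall>lam' I'. milp_feasible x y k M lam' I' \<longrightarrow> (\<Sum>j\<in>UNIV. I' $ j) \<le> (\<Sum>j\<in>UNIV. I $ j))"

end

theory Submission
  imports Defs
begin

text \<open>
  The optimal multipliers of the BCC model form a convex set of nonnegative vectors, so averaging
  yields one optimal multiplier that is positive on the whole maximal reference set at once. Once
  \<open>M\<close> times its smallest positive entry is at least 1, this multiplier together with the indicator
  of the maximal reference set is feasible for the mixed integer program. Conversely, every feasible
  point of that program is an optimal multiplier, so its support lies in the maximal reference set.
  Comparing cardinalities gives equality at an optimum.
\<close>

text \<open>Induction on \<open>A\<close>: the midpoint of a vector positive on \<open>A\<close> and
  a vector positive at the new index \<open>a\<close> is positive at all these indices, since
  nonnegative entries cannot cancel.\<close>

lemma convex_nonneg_common_positive: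
  fixes S :: "(real^'n::finite) set"
  assumes "convex S" "S \<noteq> {}" "\<And>v j. v \<in> S \<Longrightarrow> v $ j \<ge> 0"
    and "\<And>j. j \<in> A \<Longrightarrow> \<exists>v\<in>S. v $ j > 0"
  shows "\<exists>v\<in>S. \<forall>j\<in>A. v $ j > 0"
proof -
  have "finite A" by simp
  then show ?thesis
    using assms(4)
  proof (induction A)
    case empty
    then show ?case using assms(2) by auto
  next
    case (insert a A)
    obtain u where u: "u \<in> S" "\<forall>j\<in>A. u $ j > 0"
      using insert by auto
    obtain w where w: "w \<in> S" "w $ a > 0"
      using insert.prems by auto
    let ?v = "(1/2) *\<^sub>R u + (1/2) *\<^sub>R w"
    have "?v \<in> S"
      by (rule convexD[OF assms(1) u(1) w(1)]) auto
    moreover have "?v $ j > 0" if "j \<in> insert a A" for j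
      using that u w assms(3)[OF u(1), of j] assms(3)[OF w(1), of j]
      by (auto simp: add_pos_nonneg add_nonneg_pos)
    ultimately show ?case by blast
  qed
qed

lemma convex_bcc_feasible: "convex {lam. bcc_feasible x y k \<theta> lam}"
proof (rule convexI)
  fix u v :: "real^'a" and a b :: real
  assume u: "u \<in> {lam. bcc_feasible x y k \<theta> lam}" and v: "v \<in> {lam. bcc_feasible x y k \<theta> lam}"
    and a: "0 \<le> a" and b: "0 \<le> b" and ab: "a + b = 1"
  \<comment> \<open>The weights \<open>f\<close> are left arbitrary so that one identity serves the
    inputs, the outputs and, with \<open>f\<close> constantly 1, the normalisation.\<close>
  have dist: "(\<Sum>j\<in>UNIV. (a *\<^sub>R u + b *\<^sub>R v) $ j * f j)
      = a * (\<Sum>j\<in>UNIV. u $ j * f j) + b * (\<Sum>j\<in>UNIV. v $ j * f j)" for f :: "'a \<Rightarrow> real"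
    by (simp add: sum.distrib sum_distrib_left algebra_simps)
  have comb: "a * c + b * c = c" for c
    using ab by (metis distrib_right mult_1)
  have "(\<Sum>j\<in>UNIV. (a *\<^sub>R u + b *\<^sub>R v) $ j * x j $ i) \<le> \<theta> * x k $ i" for i
  proof -
    have "a * (\<Sum>j\<in>UNIV. u $ j * x j $ i) + b * (\<Sum>j\<in>UNIV. v $ j * x j $ i)
        \<le> a * (\<theta> * x k $ i) + b * (\<theta> * x k $ i)"
      using u v a b by (intro add_mono mult_left_mono) (auto simp: bcc_feasible_def)
    then show ?thesis unfolding dist comb .
  qed
  moreover have "y k $ r \<le> (\<Sum>j\<in>UNIV. (a *\<^sub>R u + b *\<^sub>R v) $ j * y j $ r)" for r
  proof -
    have "a * y k $ r + b * y k $ r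
        \<le> a * (\<Sum>j\<in>UNIV. u $ j * y j $ r) + b * (\<Sum>j\<in>UNIV. v $ j * y j $ r)"
      using u v a b by (intro add_mono mult_left_mono) (auto simp: bcc_feasible_def)
    then show ?thesis unfolding dist comb .
  qed
  moreover have "(\<Sum>j\<in>UNIV. (a *\<^sub>R u + b *\<^sub>R v) $ j) = 1"
    using dist[of "\<lambda>_. 1"] u v ab by (simp add: bcc_feasible_def)
  moreover have "(a *\<^sub>R u + b *\<^sub>R v) $ j \<ge> 0" for j
    using u v a b by (simp add: bcc_feasible_def)
  ultimately show "a *\<^sub>R u + b *\<^sub>R v \<in> {lam. bcc_feasible x y k \<theta> lam}"
    by (simp add: bcc_feasible_def)
qed

text \<open>A positive coordinate of \<open>x k\<close> forces this through its input constraint.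
  The bound 0 makes the infimum in \<open>bcc_value\<close> a genuine lower bound.\<close>

lemma bcc_feasible_theta_nonneg:
  assumes "\<And>j i. x j $ i \<ge> 0" "x k \<noteq> 0" "bcc_feasible x y k \<theta> lam"
  shows "\<theta> \<ge> 0"
proof -
  obtain i where "x k $ i \<noteq> 0"
    using assms(2) by (auto simp: vec_eq_iff)
  then have "x k $ i > 0"
    using assms(1)[of k i] by simp
  moreover have "0 \<le> (\<Sum>j\<in>UNIV. lam $ j * x j $ i)"
    using assms by (intro sum_nonneg mult_nonneg_nonneg) (auto simp: bcc_feasible_def)
  then have "0 \<le> \<theta> * x k $ i"
    using assms(3) order_trans unfolding bcc_feasible_def by blast
  ultimately show ?thesis
    by (simp add: zero_le_mult_iff)
qed

text \<open>An attained minimum equals the infimum, and the infimum is a lower bound by the previous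
  lemma. Attainment is not asserted: without it both sides are false.\<close>

lemma bcc_optimal_iff:
  assumes "\<And>j i. x j $ i \<ge> 0" "x k \<noteq> 0"
  shows "bcc_optimal x y k \<theta> lam \<longleftrightarrow> \<theta> = bcc_value x y k \<and> bcc_feasible x y k \<theta> lam"
proof
  assume "bcc_optimal x y k \<theta> lam"
  then show "\<theta> = bcc_value x y k \<and> bcc_feasible x y k \<theta> lam"
    unfolding bcc_optimal_def bcc_value_def
    by (auto intro!: cInf_eq_minimum[symmetric])
next
  have "bdd_below {\<theta>. \<exists>lam. bcc_feasible x y k \<theta> lam}"
    using bcc_feasible_theta_nonneg[of x k, OF assms] by (auto intro!: bdd_belowI[of _ 0])
  then have "bcc_value x y k \<le> \<theta>'" if "bcc_feasible x y k \<theta>' lam'" for \<theta>' lam'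
    unfolding bcc_value_def using that by (auto intro: cInf_lower)
  then show "bcc_optimal x y k \<theta> lam"
    if "\<theta> = bcc_value x y k \<and> bcc_feasible x y k \<theta> lam"
    using that by (auto simp: bcc_optimal_def)
qed

lemma mem_maximal_reference_set_iff:
  assumes "\<And>j i. x j $ i \<ge> 0" "x k \<noteq> 0"
  shows "j \<in> maximal_reference_set x y k
    \<longleftrightarrow> (\<exists>lam. bcc_feasible x y k (bcc_value x y k) lam \<and> lam $ j > 0)"
  using bcc_optimal_iff[of x k y, OF assms]
  by (auto simp: maximal_reference_set_def reference_set_def)

lemma milp_feasible_iff:
  "milp_feasible x y k M lam I \<longleftrightarrow>
    bcc_feasible x y k (bcc_value x y k) lam \<and> (\<forall>j. I $ j \<le> M * lam $ j \<and> I $ j \<in> {0, 1})"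
  by (auto simp: milp_feasible_def bcc_feasible_def)

theorem theorem1:
  fixes x :: "'n::finite \<Rightarrow> real^'m::finite"
    and y :: "'n \<Rightarrow> real^'s::finite"
    and k :: 'n
  assumes x_nonneg: "\<And>j i. x j $ i \<ge> 0"
    and y_nonneg: "\<And>j r. y j $ r \<ge> 0"
    and x_nonzero: "\<And>j. x j \<noteq> 0"
    and y_nonzero: "\<And>j. y j \<noteq> 0"
  shows "\<exists>M0>0. \<forall>M\<ge>M0. \<forall>lam I. milp_optimal x y k M lam I \<longrightarrow>
           maximal_reference_set x y k = {j. lam $ j > 0}"
proof -
  define S where "S = {lam. bcc_feasible x y k (bcc_value x y k) lam}"
  define R where "R = maximal_reference_set x y k"
  have R_iff: "j \<in> R \<longleftrightarrow> (\<exists>lam\<in>S. lam $ j > 0)" for j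
    using mem_maximal_reference_set_iff[of x k j y, OF x_nonneg x_nonzero]
    by (auto simp: R_def S_def)
  have S_nonneg: "v $ j \<ge> 0" if "v \<in> S" for v j
    using that by (simp add: S_def bcc_feasible_def)
  show ?thesis
  proof (cases "S = {}")
    \<comment> \<open>The mixed integer program is then infeasible for every \<open>M\<close>, so
      the claim is vacuous and attainment of the infimum need not be proved.\<close>
    case True
    then have "\<not> milp_optimal x y k M lam I" for M lam I
      by (auto simp: S_def milp_optimal_def milp_feasible_iff)
    then show ?thesis by (intro exI[of _ 1]) auto
  next
    case False
    have "convex S"
      unfolding S_def by (rule convex_bcc_feasible)
    with False obtain v where v: "v \<in> S" "\<forall>j\<in>R. v $ j > 0"
      using convex_nonneg_common_positive[of S R] S_nonneg R_iff by blast
    \<comment> \<open>Inserting 1 keeps the set nonempty whatever \<open>R\<close> is. The threshold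
      for \<open>M\<close> will be \<open>1 / e\<close>.\<close>
    define e where "e = Min (insert 1 ((\<lambda>j. v $ j) ` R))"
    have "e > 0"
      using v by (simp add: e_def)
    have e_le: "e \<le> v $ j" if "j \<in> R" for j
      using that by (simp add: e_def)
    have "R = {j. lam $ j > 0}" if "M \<ge> 1 / e" and opt: "milp_optimal x y k M lam I" for M lam I
    proof -
      let ?I = "(\<chi> j. if j \<in> R then 1 else 0) :: real^'n"
      have "M > 0"
        using \<open>e > 0\<close> that(1) by (meson less_le_trans zero_less_divide_1_iff)
      have "1 \<le> M * v $ j" if "j \<in> R" for j
      proof -
        have "1 \<le> M * e"
          using \<open>M \<ge> 1 / e\<close> \<open>e > 0\<close> by (simp add: field_simps)
        also have "\<dots> \<le> M * v $ j"
          using e_le[OF that] \<open>M > 0\<close> by simp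
        finally show ?thesis .
      qed
      then have "milp_feasible x y k M v ?I"
        using v(1) S_nonneg[OF v(1)] \<open>M > 0\<close> by (auto simp: milp_feasible_iff S_def)
      then have "(\<Sum>j\<in>UNIV. ?I $ j) \<le> (\<Sum>j\<in>UNIV. I $ j)"
        using opt unfolding milp_optimal_def by blast
      moreover have "(\<Sum>j\<in>UNIV. ?I $ j) = real (card R)"
        by (simp add: sum.If_cases)
      moreover have lam: "lam \<in> S" and I: "I $ j \<le> M * lam $ j" "I $ j \<in> {0, 1}" for j
        using opt by (auto simp: milp_optimal_def milp_feasible_iff S_def)
      \<comment> \<open>A binary vector is the indicator of its ones, so the objective value is a
        cardinality.\<close>
      have "I $ j = (if I $ j = 1 then 1 else 0)" for j
        using I(2)[of j] by auto
      then have "(\<Sum>j\<in>UNIV. I $ j) = (\<Sum>j\<in>UNIV. if I $ j = 1 then 1 else 0)"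
        by (intro sum.cong refl)
      then have "(\<Sum>j\<in>UNIV. I $ j) = real (card {j. I $ j = 1})"
        by (simp add: sum.If_cases)
      ultimately have card_le: "card R \<le> card {j. I $ j = 1}"
        by simp
      \<comment> \<open>Here the linking constraint reads 1 \<le>
        \<open>M * lam $ j\<close>.\<close>
      have "lam $ j > 0" if "I $ j = 1" for j
        using I(1)[of j] that \<open>M > 0\<close> by (smt (verit) zero_less_mult_pos)
      then have I_sub: "{j. I $ j = 1} \<subseteq> {j. lam $ j > 0}" by auto
      have sub_R: "{j. lam $ j > 0} \<subseteq> R"
        using lam R_iff by auto
      \<comment> \<open>The support of \<open>lam\<close> is a subset of the finite set
        \<open>R\<close> with at least as many elements, hence all of \<open>R\<close>.\<close>
      have "card R \<le> card {j. lam $ j > 0}"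
        using card_le card_mono[OF _ I_sub] by simp
      then show ?thesis
        using card_seteq[OF _ sub_R] by simp
    qed
    then show ?thesis
      using \<open>e > 0\<close> unfolding R_def by (intro exI[of _ "1 / e"]) auto
  qed
qed

end
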